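(* Let $R$ be a finite-dimensional regular quantum commutative algebra of quantum length $m$ with regular quantum commutation function $\theta$. Then all $\theta(i,j)$, $1\le i,j\le m$, are roots of $1$.
   Context: $K$ is an algebraically closed field of characteristic different from $2$; all algebras are unital associative $K$-algebras. A regular quantum commutative decomposition of an algebra $R$, of quantum length $m$, is a vector space decomposition $R=R_1\oplus\cdots\oplus R_m$ such that, with $S=\{1,\dots,m\}$: (a) for every $n\in\mathbb{N}$ and every $(i_1,\dots,i_n)\in S^n$ there exist $a_j\in R_{i_j}$, $1\le j\le n$, with $a_1\cdots a_n\neq 0$; (b) there is a function $\theta\colon S\times S\to K^*$ (the regular quantum commutation function) such that $ab=\theta(i,j)ba$ for all $i,j\in S$, $a\in R_i$, $b\in R_j$. An algebra with a fixed such decomposition and $\theta$ is called a regular quantum commutative algebra. *)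

theory Defs
  imports "HOL-Computational_Algebra.Computational_Algebra"
begin

locale unital_algebra = vector_space scale
  for scale :: "'k::field \<Rightarrow> 'r::ring_1 \<Rightarrow> 'r" (infixr "*s" 75) +
  assumes scale_mult_left: "(c *s x) * y = c *s (x * y)"
    and scale_mult_right: "x * (c *s y) = c *s (x * y)"
begin

definition finite_dimensional :: bool where
  "finite_dimensional \<longleftrightarrow> (\<exists>B. finite B \<and> span B = UNIV)"

(* The family ranges over extensional functions so that the components x i are
   unique as a function on {1..m}. *)
definition direct_decomposition :: "nat \<Rightarrow> (nat \<Rightarrow> 'r set) \<Rightarrow> bool" where
  "direct_decomposition m R \<longleftrightarrow>
     (\<forall>i\<in>{1..m}. subspace (R i)) \<and>
     (\<forall>y. \<exists>!x. x \<in> (\<Pi>\<^sub>E i\<in>{1..m}. R i) \<and> y = (\<Sum>i\<in>{1..m}. x i))"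

end

locale regular_quantum_commutative_algebra = unital_algebra scale
  for scale :: "'k::field \<Rightarrow> 'r::ring_1 \<Rightarrow> 'r" (infixr "*s" 75) +
  fixes m :: nat
    and R :: "nat \<Rightarrow> 'r set"
    and \<theta> :: "nat \<Rightarrow> nat \<Rightarrow> 'k"
  assumes decomposition: "direct_decomposition m R"
    (* The list js is the tuple (i_1, ..., i_n) and as is (a_1, ..., a_n). The case n = 0
       only says 1 \<noteq> 0. *)
    and regular: "set js \<subseteq> {1..m} \<Longrightarrow>
      \<exists>as. list_all2 (\<lambda>a i. a \<in> R i) as js \<and> prod_list as \<noteq> 0"
    and theta_nonzero: "i \<in> {1..m} \<Longrightarrow> j \<in> {1..m} \<Longrightarrow> \<theta> i j \<noteq> 0"
    and quantum_commute: "i \<in> {1..m} \<Longrightarrow> j \<in> {1..m} \<Longrightarrow> a \<in> R i \<Longrightarrow> b \<in> R j \<Longrightarrow>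
      a * b = \<theta> i j *s (b * a)"

definition root_of_one :: "'k::monoid_mult \<Rightarrow> bool" where
  "root_of_one z \<longleftrightarrow> (\<exists>n>0. z ^ n = 1)"

end

theory Submission
  imports Defs
begin

text \<open>
  Suppose that \<open>q = \<theta> i j\<close> is not a root of one.  For \<open>a \<in> R i\<close> and \<open>b \<in> R j\<close> the powers of
  \<open>b\<close> are linearly dependent, because the algebra is finite-dimensional.  Moving \<open>a\<close> past \<open>b ^ e\<close>
  produces the factor \<open>q ^ e\<close>, and these factors are distinct, so comparing multiplication by \<open>a\<close>
  on the left and on the right shortens the relation term by term until only a single monomial is
  left: \<open>b ^ N * a ^ N = 0\<close> for some \<open>N\<close> (lemma \<open>power_mult_power_eq_0\<close>).  One \<open>N\<close> serves all
  pairs of elements of finite spanning sets of \<open>R j\<close> and \<open>R i\<close>.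

  On the other hand, expand a product of many factors from \<open>R j\<close> followed by many factors from
  \<open>R i\<close> multilinearly in these spanning sets.  By the pigeonhole principle, each word in spanning
  elements of \<open>R j\<close> contains some \<open>b\<close> at least \<open>N\<close> times, and as elements of \<open>R j\<close> commute up to
  scalars, these copies can be gathered at the right end; likewise, some \<open>a\<close> can be gathered \<open>N\<close>
  times at the left end of the second word.  So every term contains \<open>b ^ N * a ^ N = 0\<close>, and all
  such products vanish, against regularity.
\<close>

section \<open>Eliminating terms from a relation between powers\<close>

lemma inj_power_if_not_root_of_one:
  fixes q :: "'k::field"
  assumes "q \<noteq> 0" "\<not> root_of_one q"
  shows "inj (\<lambda>n. q ^ n)"
proof (rule linorder_injI)
  fix e f :: nat
  assume "e < f"
  show "q ^ e \<noteq> q ^ f"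
  proof
    assume "q ^ e = q ^ f"
    moreover have "q ^ f = q ^ e * q ^ (f - e)"
      using \<open>e < f\<close> by (simp flip: power_add)
    ultimately have "q ^ (f - e) = 1"
      using assms(1) by simp
    then show False
      using assms(2) \<open>e < f\<close> unfolding root_of_one_def by (metis zero_less_diff)
  qed
qed

lemma power_mult_power_eq_0_mono:
  fixes a b :: "'r::semiring_1"
  assumes "b ^ e * a ^ r = 0" "e \<le> N" "r \<le> N"
  shows "b ^ N * a ^ N = 0"
proof -
  have "b ^ N * a ^ N = (b ^ (N - e) * b ^ e) * (a ^ r * a ^ (N - r))"
    using assms(2,3) by (simp flip: power_add)
  also have "\<dots> = b ^ (N - e) * (b ^ e * a ^ r) * a ^ (N - r)"
    by (simp add: mult.assoc)
  finally show ?thesis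
    using assms(1) by simp
qed

context unital_algebra
begin

lemma q_commute_power:
  assumes "a * b = q *s (b * a)"
  shows "a * b ^ n = q ^ n *s (b ^ n * a)"
proof (induction n)
  case (Suc n)
  have "a * b ^ Suc n = (a * b) * b ^ n"
    by (simp add: mult.assoc)
  also have "\<dots> = q *s (b * (a * b ^ n))"
    by (simp add: assms scale_mult_left mult.assoc)
  finally show ?case
    by (simp add: Suc.IH scale_mult_right mult.assoc)
qed simp

lemma finite_if_independent:
  assumes "finite_dimensional" "independent B"
  shows "finite B"
  using assms independent_span_bound unfolding finite_dimensional_def by blast

lemma powers_dependent:
  assumes "finite_dimensional"
  obtains E k where "finite E" "E \<noteq> {}" "\<And>e. e \<in> E \<Longrightarrow> k e \<noteq> 0"
    "(\<Sum>e\<in>E. k e *s b ^ e) = 0"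
proof (cases "inj (\<lambda>n. b ^ n)")
  case False
  then obtain e f where "e \<noteq> f" "b ^ e = b ^ f"
    by (auto simp: inj_def)
  then show ?thesis
    by (intro that[of "{e, f}" "\<lambda>n. if n = e then 1 else - 1"]) auto
next
  case True
  then have "infinite (range (\<lambda>n. b ^ n))"
    by (simp add: finite_image_iff)
  then have "dependent (range (\<lambda>n. b ^ n))"
    using finite_if_independent assms by blast
  then obtain t u where t: "finite t" "t \<subseteq> range (\<lambda>n. b ^ n)" "(\<Sum>v\<in>t. u v *s v) = 0"
    and nonzero: "\<exists>v\<in>t. u v \<noteq> 0"
    unfolding dependent_explicit by blast
  \<comment> \<open>Only the support of the relation is kept, because the coefficients have to be nonzero.\<close>
  define s where "s = {v \<in> t. u v \<noteq> 0}"
  have "s \<subseteq> range (\<lambda>n. b ^ n)"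
    using t(2) by (auto simp: s_def)
  then obtain E where E: "s = (\<lambda>n. b ^ n) ` E"
    by (auto simp: subset_image_iff)
  have inj: "inj_on (\<lambda>n. b ^ n) E"
    using True by (rule inj_on_subset) simp
  show ?thesis
  proof (rule that[of E "\<lambda>e. u (b ^ e)"])
    show "finite E"
    proof (rule finite_imageD[OF _ inj])
      show "finite ((\<lambda>n. b ^ n) ` E)"
        using t(1) unfolding E[symmetric] s_def by simp
    qed
    show "E \<noteq> {}"
      using nonzero E by (auto simp: s_def)
    show "u (b ^ e) \<noteq> 0" if "e \<in> E" for e
      using that E by (auto simp: s_def)
    have "(\<Sum>e\<in>E. u (b ^ e) *s b ^ e) = (\<Sum>v\<in>s. u v *s v)"
      unfolding E by (simp add: sum.reindex[OF inj])
    also have "\<dots> = (\<Sum>v\<in>t. u v *s v)"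
      using t(1) by (intro sum.mono_neutral_left) (auto simp: s_def)
    finally show "(\<Sum>e\<in>E. u (b ^ e) *s b ^ e) = 0"
      using t(3) by simp
  qed
qed

text \<open>
  This is the elimination argument.  Multiplying a relation by \<open>a\<close> on the left multiplies the
  \<open>e\<close>-th coefficient by \<open>q ^ e\<close>; multiplying it by \<open>a\<close> on the right leaves the coefficients alone.
  So one exponent \<open>e0\<close> cancels after scaling by \<open>q ^ e0\<close>, and no other does, at the price of one
  more factor \<open>a\<close>.  This is why the statement carries the exponent \<open>r\<close>.
\<close>

lemma monomial_eq_0_if_relation:
  assumes commute: "a * b = q *s (b * a)" and inj: "inj (\<lambda>n. q ^ n)"
    and "finite E" "E \<noteq> {}" "\<And>e. e \<in> E \<Longrightarrow> k e \<noteq> 0"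
    and "(\<Sum>e\<in>E. k e *s (b ^ e * a ^ r)) = 0"
  shows "\<exists>N. b ^ N * a ^ N = 0"
  using assms(3-)
proof (induction E arbitrary: k r rule: finite_psubset_induct)
  case (psubset E)
  then obtain e0 where e0: "e0 \<in> E"
    by auto
  show ?case
  proof (cases "E = {e0}")
    case True
    then have "b ^ e0 * a ^ r = 0"
      using psubset.prems by simp
    then show ?thesis
      using power_mult_power_eq_0_mono[of b e0 a r "max e0 r"] by auto
  next
    case False
    define k' where "k' = (\<lambda>e. k e * (q ^ e - q ^ e0))"
    have left: "a * (k e *s (b ^ e * a ^ r)) = (k e * q ^ e) *s (b ^ e * a ^ Suc r)" for e
      using q_commute_power[OF commute, of e]
      by (simp add: scale_mult_right scale_mult_left flip: mult.assoc)
    have right: "q ^ e0 *s (k e *s (b ^ e * a ^ r) * a) = (k e * q ^ e0) *s (b ^ e * a ^ Suc r)"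
      for e
      by (simp add: scale_mult_left mult.assoc power_commutes mult.commute)
    have "(\<Sum>e\<in>E. k' e *s (b ^ e * a ^ Suc r)) =
        (\<Sum>e\<in>E. a * (k e *s (b ^ e * a ^ r)) - q ^ e0 *s (k e *s (b ^ e * a ^ r) * a))"
      unfolding left right k'_def
      by (simp add: right_diff_distrib scale_left_diff_distrib)
    also have "\<dots> = a * (\<Sum>e\<in>E. k e *s (b ^ e * a ^ r)) -
        q ^ e0 *s ((\<Sum>e\<in>E. k e *s (b ^ e * a ^ r)) * a)"
      by (simp add: sum_subtractf sum_distrib_left sum_distrib_right scale_sum_right)
    also have "\<dots> = 0"
      using psubset.prems by simp
    finally have "(\<Sum>e\<in>E - {e0}. k' e *s (b ^ e * a ^ Suc r)) = 0"
      using psubset.hyps e0 by (simp add: sum.remove[of E e0] k'_def)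
    moreover have "k' e \<noteq> 0" if "e \<in> E - {e0}" for e
      using that psubset.prems(2) inj by (auto simp: k'_def inj_def)
    ultimately show ?thesis
      using psubset.IH[of "E - {e0}" k' "Suc r"] e0 False by blast
  qed
qed

lemma power_mult_power_eq_0:
  assumes "finite_dimensional" "a * b = q *s (b * a)" "q \<noteq> 0" "\<not> root_of_one q"
  shows "\<exists>N. b ^ N * a ^ N = 0"
proof -
  obtain E k where "finite E" "E \<noteq> {}" "\<And>e. e \<in> E \<Longrightarrow> k e \<noteq> 0" "(\<Sum>e\<in>E. k e *s b ^ e) = 0"
    using powers_dependent[OF assms(1), of b] by metis
  then show ?thesis
    using monomial_eq_0_if_relation[OF assms(2) inj_power_if_not_root_of_one[OF assms(3,4)],
        of E k 0] by simp
qed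

end

section \<open>Words whose letters commute up to scalars\<close>

lemma frequent_element_in_long_list:
  assumes "finite A" "set xs \<subseteq> A" "length xs > card A * M"
  obtains x where "x \<in> set xs" "count_list xs x \<ge> M"
proof -
  have "\<exists>x\<in>set xs. count_list xs x \<ge> M"
  proof (rule ccontr)
    assume "\<not> ?thesis"
    then have "count_list xs x \<le> M" if "x \<in> set xs" for x
      using that by (meson less_imp_le not_le)
    then have "sum (count_list xs) (set xs) \<le> card (set xs) * M"
      using sum_bounded_above[of "set xs" "count_list xs" M] by simp
    also have "\<dots> \<le> card A * M"
      using assms by (simp add: card_mono)
    finally show False
      using assms(3) by (simp add: sum_count_set)
  qed
  then show ?thesis
    using that by blast
qed

context unital_algebra
begin

lemma q_commute_power_left:
  assumes "a * b = q *s (b * a)"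
  shows "a ^ n * b = q ^ n *s (b * a ^ n)"
proof (induction n)
  case (Suc n)
  have "a ^ Suc n * b = a * (a ^ n * b)"
    by (simp add: mult.assoc)
  also have "\<dots> = q ^ n *s ((a * b) * a ^ n)"
    by (simp add: Suc.IH scale_mult_right mult.assoc)
  finally show ?case
    by (simp add: assms scale_mult_left mult.assoc mult.commute)
qed simp

text \<open>
  In a word whose letters commute up to scalars, the copies of one letter can be brought together
  at either end.  The scalar \<open>q\<close> also applies to \<open>y = x\<close>, where it may differ from \<open>1\<close> if
  \<open>x * x = 0\<close>; equal letters are never interchanged in the proof.
\<close>

lemma gather_left:
  assumes "\<And>y. y \<in> set xs \<Longrightarrow> y * x = q *s (x * y)"
  shows "\<exists>c. prod_list xs = c *s (x ^ count_list xs x * prod_list (removeAll x xs))"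
  using assms
proof (induction xs)
  case Nil
  show ?case
    by (auto intro: exI[of _ 1])
next
  case (Cons y xs)
  then obtain c where c: "prod_list xs = c *s (x ^ count_list xs x * prod_list (removeAll x xs))"
    by auto
  let ?n = "count_list xs x" and ?p = "prod_list (removeAll x xs)"
  show ?case
  proof (cases "y = x")
    case True
    then show ?thesis
      using c by (auto simp: scale_mult_right mult.assoc intro: exI[of _ c])
  next
    case False
    have "y * (x ^ ?n * ?p) = q ^ ?n *s (x ^ ?n * (y * ?p))"
      using q_commute_power[of y x q ?n] Cons.prems
      by (simp add: scale_mult_left flip: mult.assoc)
    then show ?thesis
      using False c by (auto simp: scale_mult_right intro: exI[of _ "c * q ^ ?n"])
  qed
qed

lemma gather_right:
  assumes "\<And>y. y \<in> set xs \<Longrightarrow> x * y = q *s (y * x)"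
  shows "\<exists>c. prod_list xs = c *s (prod_list (removeAll x xs) * x ^ count_list xs x)"
  using assms
proof (induction xs rule: rev_induct)
  case Nil
  show ?case
    by (auto intro: exI[of _ 1])
next
  case (snoc y xs)
  then obtain c where c: "prod_list xs = c *s (prod_list (removeAll x xs) * x ^ count_list xs x)"
    by auto
  let ?n = "count_list xs x" and ?p = "prod_list (removeAll x xs)"
  show ?case
  proof (cases "y = x")
    case True
    then show ?thesis
      using c by (auto simp: scale_mult_left mult.assoc power_commutes intro: exI[of _ c])
  next
    case False
    have "?p * x ^ ?n * y = q ^ ?n *s (?p * y * x ^ ?n)"
      using q_commute_power_left[of x y q ?n] snoc.prems
      by (simp add: scale_mult_right mult.assoc)
    then show ?thesis
      using False c by (auto simp: scale_mult_left intro: exI[of _ "c * q ^ ?n"])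
  qed
qed

end

section \<open>Multilinear expansion in spanning sets\<close>

context unital_algebra
begin

lemma mult_mem_span:
  assumes "x \<in> span X" "y \<in> span Y" "\<And>u v. u \<in> X \<Longrightarrow> v \<in> Y \<Longrightarrow> u * v \<in> span Z"
  shows "x * y \<in> span Z"
proof -
  have right: "u * y \<in> span Z" if "u \<in> X" for u
    using assms(2)
  proof (induction rule: span_induct_alt)
    case (step c v z)
    then show ?case
      using assms(3)[OF that] by (simp add: distrib_left scale_mult_right span_add span_scale)
  qed (simp add: span_zero)
  show ?thesis
    using assms(1)
  proof (induction rule: span_induct_alt)
    case (step c u z)
    then show ?case
      using right by (simp add: distrib_right scale_mult_left span_add span_scale)
  qed (simp add: span_zero)
qed

lemma prod_list_mem_span_words:
  assumes "set as \<subseteq> span A"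
  shows "prod_list as \<in> span (prod_list ` {ws. set ws \<subseteq> A \<and> length ws = length as})"
  using assms
proof (induction as)
  case Nil
  show ?case
    by (auto intro!: span_base image_eqI[of _ _ "[]"])
next
  case (Cons a as)
  have "a * prod_list as \<in> span (prod_list ` {ws. set ws \<subseteq> A \<and> length ws = length (a # as)})"
  proof (rule mult_mem_span)
    show "a \<in> span A"
      using Cons.prems by simp
    show "prod_list as \<in> span (prod_list ` {ws. set ws \<subseteq> A \<and> length ws = length as})"
      using Cons by simp
  next
    fix u v
    assume "u \<in> A" "v \<in> prod_list ` {ws. set ws \<subseteq> A \<and> length ws = length as}"
    then obtain ws where "set ws \<subseteq> A" "length ws = length as" "v = prod_list ws"
      by auto
    with \<open>u \<in> A\<close> show "u * v \<in> span (prod_list ` {ws. set ws \<subseteq> A \<and> length ws = length (a # as)})"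
      by (intro span_base image_eqI[of _ _ "u # ws"]) auto
  qed
  then show ?case
    by simp
qed

lemma finite_spanning_subset:
  assumes "finite_dimensional"
  obtains B where "finite B" "B \<subseteq> V" "V \<subseteq> span B"
  using basis_exists[of V] finite_if_independent[OF assms] by metis

end

section \<open>Commutation factors of finite-dimensional algebras\<close>

theorem corollary30:
  fixes scale :: "'k::alg_closed_field \<Rightarrow> 'r::ring_1 \<Rightarrow> 'r"
    and m :: nat
    and R :: "nat \<Rightarrow> 'r set"
    and \<theta> :: "nat \<Rightarrow> nat \<Rightarrow> 'k"
  assumes "CHAR('k) \<noteq> 2"
    and "regular_quantum_commutative_algebra scale m R \<theta>"
    and "unital_algebra.finite_dimensional scale"
  shows "\<forall>i\<in>{1..m}. \<forall>j\<in>{1..m}. root_of_one (\<theta> i j)"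
proof (intro ballI, rule ccontr)
  fix i j
  assume i: "i \<in> {1..m}" and j: "j \<in> {1..m}" and not_root: "\<not> root_of_one (\<theta> i j)"
  interpret regular_quantum_commutative_algebra scale m R \<theta>
    by fact
  obtain A where A: "finite A" "A \<subseteq> R i" "R i \<subseteq> span A"
    using finite_spanning_subset[OF assms(3)] .
  obtain B where B: "finite B" "B \<subseteq> R j" "R j \<subseteq> span B"
    using finite_spanning_subset[OF assms(3)] .
  have "\<exists>N. b ^ N * a ^ N = 0" if "a \<in> A" "b \<in> B" for a b
    using power_mult_power_eq_0[OF assms(3) _ theta_nonzero[OF i j] not_root]
      quantum_commute[OF i j] that A(2) B(2) by blast
  then obtain N where N: "\<And>a b. a \<in> A \<Longrightarrow> b \<in> B \<Longrightarrow> b ^ N a b * a ^ N a b = 0"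
    by metis
  \<comment> \<open>The sum is just an upper bound for all exponents that also makes sense for empty \<open>A\<close> or \<open>B\<close>.\<close>
  define M where "M = (\<Sum>a\<in>A. \<Sum>b\<in>B. N a b)"
  have N_le_M: "N a b \<le> M" if "a \<in> A" "b \<in> B" for a b
  proof -
    have "N a b \<le> (\<Sum>b\<in>B. N a b)"
      using B(1) that by (simp add: member_le_sum)
    also have "\<dots> \<le> M"
      unfolding M_def using A(1) that by (intro member_le_sum) auto
    finally show ?thesis .
  qed
  have words_eq_0: "prod_list vs * prod_list us = 0"
    if vs: "set vs \<subseteq> B" "length vs = Suc (card B * M)"
      and us: "set us \<subseteq> A" "length us = Suc (card A * M)" for vs us
  proof -
    obtain b where b: "b \<in> set vs" "count_list vs b \<ge> M"
      using frequent_element_in_long_list[OF B(1) vs(1), of M] vs(2) by auto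
    obtain a where a: "a \<in> set us" "count_list us a \<ge> M"
      using frequent_element_in_long_list[OF A(1) us(1), of M] us(2) by auto
    have "b * y = scale (\<theta> j j) (y * b)" if "y \<in> set vs" for y
      using that b(1) vs(1) B(2) by (intro quantum_commute[OF j j]) auto
    then obtain c where c: "prod_list vs = scale c (prod_list (removeAll b vs) * b ^ count_list vs b)"
      using gather_right[of vs b] by metis
    have "y * a = scale (\<theta> i i) (a * y)" if "y \<in> set us" for y
      using that a(1) us(1) A(2) by (intro quantum_commute[OF i i]) auto
    then obtain d where d: "prod_list us = scale d (a ^ count_list us a * prod_list (removeAll a us))"
      using gather_left[of us a] by metis
    have mem: "a \<in> A" "b \<in> B"
      using a(1) b(1) us(1) vs(1) by blast+
    have "b ^ M * a ^ M = 0"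
      using power_mult_power_eq_0_mono[OF N[OF mem] N_le_M[OF mem] N_le_M[OF mem]] .
    moreover have "b ^ count_list vs b = b ^ (count_list vs b - M) * b ^ M"
      "a ^ count_list us a = a ^ M * a ^ (count_list us a - M)"
      using a(2) b(2) by (simp_all flip: power_add)
    ultimately have "b ^ count_list vs b * a ^ count_list us a = 0"
      by (metis mult.assoc mult_zero_left mult_zero_right)
    then have "prod_list (removeAll b vs) * b ^ count_list vs b *
        (a ^ count_list us a * prod_list (removeAll a us)) = 0"
      by (metis mult.assoc mult_zero_left mult_zero_right)
    then show ?thesis
      unfolding c d by (simp add: scale_mult_left scale_mult_right)
  qed
  have "\<exists>as. list_all2 (\<lambda>a i. a \<in> R i) as
      (replicate (Suc (card B * M)) j @ replicate (Suc (card A * M)) i) \<and> prod_list as \<noteq> 0"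
    using i j by (intro regular) auto
  then obtain vs us where
    vs: "list_all2 (\<lambda>a i. a \<in> R i) vs (replicate (Suc (card B * M)) j)"
    and us: "list_all2 (\<lambda>a i. a \<in> R i) us (replicate (Suc (card A * M)) i)"
    and nonzero: "prod_list vs * prod_list us \<noteq> 0"
    by (auto simp: list_all2_append2 simp del: replicate.simps)
  have len: "length vs = Suc (card B * M)" "length us = Suc (card A * M)"
    using vs us by (auto dest!: list_all2_lengthD simp del: replicate.simps)
  have "set vs \<subseteq> R j" "set us \<subseteq> R i"
    using vs us len by (auto simp: list_all2_conv_all_nth in_set_conv_nth simp del: replicate.simps)
  then have "set vs \<subseteq> span B" "set us \<subseteq> span A"
    using A(3) B(3) by auto
  then have "prod_list vs * prod_list us \<in> span {}"
    by (rule mult_mem_span[OF prod_list_mem_span_words prod_list_mem_span_words])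
      (auto simp: len words_eq_0)
  with nonzero show False
    by simp
qed

end
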